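(* Let $\vec r=\langle r_0,\dots,r_{n-1}\rangle$ be a finite tuple of parameters and let $\varphi\in\mathrm{Fm}(p,\vec r)$. Then $\varphi$ is $\mathrm{S5}$-additive (with respect to $p$) if and only if $\varphi$ is $\mathrm{S5}$-equivalent to a formula from $$A_{\mathrm{S5}}=\Bigl\{(\lambda\wedge p)\vee\bigvee_{i<k}\bigl(\mu_i\wedge\Diamond(\nu_i\wedge p)\bigr)\vee\varkappa \;\Bigm|\; k\in\omega;\ \varkappa,\lambda,\mu_i,\nu_i\in\mathrm{Fm}(\vec r)\Bigr\}.$$
   Context: Modal formulas are built from propositional variables using Boolean connectives, $\bot$, $\top$, $\Diamond$ and $\Box$. The variable $p$ and the variable $q$ are distinct non-parameter variables; parameters are variables distinct from $p$ and $q$. $\mathrm{Fm}(p,\vec r)$ is the set of modal formulas containing no variables other than $p,r_0,\dots,r_{n-1}$; $\mathrm{Fm}(\vec r)$ is the set of modal formulas containing no variables other than $r_0,\dots,r_{n-1}$. For a normal modal logic $\Lambda$, formulas $\varphi,\psi$ are $\Lambda$-equivalent if $\Lambda\vdash\varphi\leftrightarrow\psi$. A formula $\varphi(p,\vec r)$ is $\Lambda$-additive if $\Lambda\vdash\varphi(p\vee q,\vec r)\leftrightarrow\varphi(p,\vec r)\vee\varphi(q,\vec r)$. $\mathrm{S5}$ is the usual normal modal logic of frames whose relation is an equivalence relation. An empty disjunction is $\bot$. *)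

theory Defs
  imports Main
begin

datatype (vars: 'v) fm =
    Var 'v
  | Bot
  | Top
  | Neg "'v fm"
  | And "'v fm" "'v fm"
  | Or "'v fm" "'v fm"
  | Imp "'v fm" "'v fm"
  | Iff "'v fm" "'v fm"
  | Dia "'v fm"
  | Box "'v fm"

definition Fm :: "'v set \<Rightarrow> 'v fm set" where
  "Fm X = {\<phi>. vars \<phi> \<subseteq> X}"

primrec subst :: "('v \<Rightarrow> 'v fm) \<Rightarrow> 'v fm \<Rightarrow> 'v fm" where
  "subst s (Var x) = s x"
| "subst s Bot = Bot"
| "subst s Top = Top"
| "subst s (Neg a) = Neg (subst s a)"
| "subst s (And a b) = And (subst s a) (subst s b)"
| "subst s (Or a b) = Or (subst s a) (subst s b)"
| "subst s (Imp a b) = Imp (subst s a) (subst s b)"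
| "subst s (Iff a b) = Iff (subst s a) (subst s b)"
| "subst s (Dia a) = Dia (subst s a)"
| "subst s (Box a) = Box (subst s a)"

definition subst1 :: "'v fm \<Rightarrow> 'v \<Rightarrow> 'v fm \<Rightarrow> 'v fm" where
  "subst1 \<phi> p \<psi> = subst (Var(p := \<psi>)) \<phi>"

fun BigOr :: "'v fm list \<Rightarrow> 'v fm" where
  "BigOr [] = Bot"
| "BigOr [a] = a"
| "BigOr (a # b # as) = Or a (BigOr (b # as))"

text \<open>A logic is represented by its set of theorems.\<close>

definition equivalent :: "'v fm set \<Rightarrow> 'v fm \<Rightarrow> 'v fm \<Rightarrow> bool" where
  "equivalent L \<phi> \<psi> \<longleftrightarrow> Iff \<phi> \<psi> \<in> L"

text \<open>Additivity of \<open>\<phi>\<close> in \<open>p\<close>; it is meant for a variable \<open>q\<close> that is distinct from \<open>p\<close> and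
  does not occur in \<open>\<phi>\<close>.\<close>

definition additive :: "'v fm set \<Rightarrow> 'v \<Rightarrow> 'v \<Rightarrow> 'v fm \<Rightarrow> bool" where
  "additive L p q \<phi> \<longleftrightarrow>
     Iff (subst1 \<phi> p (Or (Var p) (Var q))) (Or \<phi> (subst1 \<phi> p (Var q))) \<in> L"

text \<open>Satisfaction at a world of a Kripke frame \<open>(W, R)\<close>; \<open>V x\<close> is the set of worlds where \<open>x\<close> is
  true.\<close>

primrec sat :: "'w set \<Rightarrow> ('w \<times> 'w) set \<Rightarrow> ('v \<Rightarrow> 'w set) \<Rightarrow> 'w \<Rightarrow> 'v fm \<Rightarrow> bool" where
  "sat W R V w (Var x) \<longleftrightarrow> w \<in> V x"
| "sat W R V w Bot \<longleftrightarrow> False"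
| "sat W R V w Top \<longleftrightarrow> True"
| "sat W R V w (Neg a) \<longleftrightarrow> \<not> sat W R V w a"
| "sat W R V w (And a b) \<longleftrightarrow> sat W R V w a \<and> sat W R V w b"
| "sat W R V w (Or a b) \<longleftrightarrow> sat W R V w a \<or> sat W R V w b"
| "sat W R V w (Imp a b) \<longleftrightarrow> (sat W R V w a \<longrightarrow> sat W R V w b)"
| "sat W R V w (Iff a b) \<longleftrightarrow> (sat W R V w a \<longleftrightarrow> sat W R V w b)"
| "sat W R V w (Dia a) \<longleftrightarrow> (\<exists>u\<in>W. (w, u) \<in> R \<and> sat W R V u a)"
| "sat W R V w (Box a) \<longleftrightarrow> (\<forall>u\<in>W. (w, u) \<in> R \<longrightarrow> sat W R V u a)"

definition valid_in :: "'w set \<Rightarrow> ('w \<times> 'w) set \<Rightarrow> 'v fm \<Rightarrow> bool" where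
  "valid_in W R \<phi> \<longleftrightarrow> (\<forall>V. \<forall>w\<in>W. sat W R V w \<phi>)"

text \<open>HOL cannot quantify over all types of worlds inside a definition, so the frames range over
  subsets of \<^typ>\<open>nat\<close>. The lemma \<open>S5_valid_in\<close> below shows that this loses nothing: members of
  \<open>S5\<close> are valid in every equivalence frame over any type of worlds.\<close>

definition S5 :: "'v fm set" where
  "S5 = {\<phi>. \<forall>(W :: nat set) R. equiv W R \<longrightarrow> valid_in W R \<phi>}"

definition A_S5 :: "'v \<Rightarrow> 'v list \<Rightarrow> 'v fm set" where
  "A_S5 p rs =
     {Or (Or (And l (Var p)) (BigOr (map (\<lambda>i. And (m i) (Dia (And (n i) (Var p)))) [0..<k]))) c
      | (k :: nat) c l m n.
          c \<in> Fm (set rs) \<and> l \<in> Fm (set rs) \<and> (\<forall>i<k. m i \<in> Fm (set rs) \<and> n i \<in> Fm (set rs))}"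

lemma finite_vars: "finite (vars \<phi>)"
  by (induction \<phi>) auto

lemma S5_valid_in:
  fixes W :: "'w set" and \<phi> :: "'v fm"
  assumes "\<phi> \<in> S5" and eq: "equiv W R"
  shows "valid_in W R \<phi>"
  unfolding valid_in_def
proof (intro allI ballI)
  fix V :: "'v \<Rightarrow> 'w set" and w assume w: "w \<in> W"
  define P where "P = vars \<phi>"
  define f where "f = (\<lambda>x. {v \<in> P. x \<in> V v})"
  define C where "C = R `` {w}"
  have refl: "(w, w) \<in> R" and "sym R" and "trans R"
    using eq w by (auto simp: equiv_def refl_on_def)
  then have R_C: "(x, u) \<in> R \<longleftrightarrow> u \<in> C" if "x \<in> C" for x u
    using that unfolding C_def by (meson Image_singleton_iff symD transD)
  have C_W: "C \<subseteq> W"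
    using eq unfolding C_def by (auto simp: equiv_def)
  have "finite P"
    unfolding P_def by (rule finite_vars)
  moreover have "f ` C \<subseteq> Pow P"
    unfolding f_def by auto
  ultimately have "finite (f ` C)"
    using finite_subset by blast
  then obtain g :: "'v set \<Rightarrow> nat" where g: "inj_on g (f ` C)"
    by (metis finite_imp_inj_to_nat_seg)
  define h where "h = (\<lambda>x. g (f x))"
  define V' where "V' = (\<lambda>v. h ` {x \<in> C. x \<in> V v})"
  define R' where "R' = (h ` C) \<times> (h ` C)"
  have V': "h x \<in> V' v \<longleftrightarrow> x \<in> V v" if "x \<in> C" "v \<in> P" for x v
  proof
    assume "h x \<in> V' v"
    then obtain y where "y \<in> C" "y \<in> V v" "h x = h y"
      unfolding V'_def by auto
    then have "f x = f y"
      using g \<open>x \<in> C\<close> unfolding h_def by (auto dest: inj_onD)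
    then show "x \<in> V v"
      using \<open>y \<in> V v\<close> \<open>v \<in> P\<close> unfolding f_def by auto
  qed (use that in \<open>auto simp: V'_def\<close>)
  have sat: "sat (h ` C) R' V' (h x) \<psi> \<longleftrightarrow> sat W R V x \<psi>" if "x \<in> C" "vars \<psi> \<subseteq> P" for x \<psi>
    using that
  proof (induction \<psi> arbitrary: x)
    case (Dia \<psi>)
    then show ?case
      using C_W by (auto simp: R'_def R_C)
  next
    case (Box \<psi>)
    then show ?case
      using C_W by (auto simp: R'_def R_C)
  qed (auto simp: V')
  have "equiv (h ` C) R'"
    unfolding R'_def by (auto simp: equiv_def refl_on_def sym_def trans_def)
  then have "valid_in (h ` C) R' \<phi>"
    using assms(1) unfolding S5_def by blast
  then show "sat W R V w \<phi>"
    using sat[of w \<phi>] refl unfolding valid_in_def C_def P_def by auto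
qed

end

theory Submission
  imports Defs
begin

text \<open>A point of an S5-cluster matters only through the set \<open>s\<close> of parameters true at it and the
  truth value of \<open>p\<close>, so a cluster is a set \<open>X\<close> of pairs \<open>(s, a)\<close>. Write \<open>F X x\<close> for the truth of
  \<open>\<phi>\<close> at \<open>x\<close> in \<open>X\<close>, and let \<open>T\<close> be the set of first components of \<open>X\<close>. Adding to \<open>X\<close> points
  at which \<open>p\<close> fails, which costs nothing because parameter states may be duplicated, additivity
  shows that \<open>F X (t, a)\<close> holds iff \<open>\<phi>\<close> holds at \<open>t\<close> when \<open>p\<close> is empty on \<open>T\<close>, or \<open>a\<close> is true and
  \<open>\<phi>\<close> holds at \<open>t\<close> when \<open>p\<close> is true at this point only, or there is some \<open>(s, True) \<in> X\<close> such that
  \<open>\<phi>\<close> holds at \<open>t\<close> when \<open>p\<close> is true only at a point with state \<open>s\<close> other than the current one.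
  Besides \<open>a\<close> and \<open>s\<close>, these three conditions depend on \<open>(T, t)\<close> only, and every property of
  \<open>(T, t)\<close> is expressible by a formula in the finitely many parameters.\<close>

section \<open>Satisfaction under substitution and surjections of clusters\<close>

text \<open>Every point of \<open>C\<close> sees exactly \<open>C\<close>, so \<open>f\<close>
  preserves and reflects the modal operators between \<open>C\<close> and its image. The
  substitution is built in so that one induction covers \<open>\<phi>(p)\<close>,
  \<open>\<phi>(q)\<close> and \<open>\<phi>(p \<or> q)\<close>.\<close>

lemma sat_image:
  assumes "equiv W R" and "C \<in> W // R" and "x \<in> C"
    and "\<And>y v. y \<in> C \<Longrightarrow> v \<in> vars \<phi> \<Longrightarrow> f y \<in> U v \<longleftrightarrow> sat W R V y (s v)"
  shows "sat W R V x (subst s \<phi>) \<longleftrightarrow> sat (f ` C) (f ` C \<times> f ` C) U (f x) \<phi>"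
proof -
  have "C \<subseteq> W"
    using assms(1,2) by (rule in_quotient_imp_subset)
  have rel: "(x, u) \<in> R \<longleftrightarrow> u \<in> C" if "x \<in> C" for x u
    using that in_quotient_imp_closed[OF assms(1,2)] in_quotient_imp_in_rel[OF assms(1,2)] by blast
  show ?thesis
    using assms(3,4) by (induction \<phi> arbitrary: x) (use \<open>C \<subseteq> W\<close> in \<open>auto simp: rel\<close>)
qed

lemma sat_subst: "sat W R V w (subst s \<phi>) \<longleftrightarrow> sat W R (\<lambda>v. {y. sat W R V y (s v)}) w \<phi>"
  by (induction \<phi> arbitrary: w) auto

lemma subst_Var: "subst Var \<phi> = \<phi>"
  by (induction \<phi>) auto

lemma subst1_fresh: "p \<notin> vars \<phi> \<Longrightarrow> subst1 \<phi> p \<chi> = \<phi>"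
  unfolding subst1_def by (induction \<phi>) auto

lemma sat_BigOr: "sat W R V w (BigOr as) \<longleftrightarrow> (\<exists>a\<in>set as. sat W R V w a)"
  by (induction as rule: BigOr.induct) auto

lemma vars_BigOr: "vars (BigOr as) = (\<Union>a\<in>set as. vars a)"
  by (induction as rule: BigOr.induct) auto

lemma subst_BigOr: "subst s (BigOr as) = BigOr (map (subst s) as)"
  by (induction as rule: BigOr.induct) auto

section \<open>Clusters whose points are pairs\<close>

text \<open>Points carry their own valuation, so a set of pairs by itself determines a one-cluster
  model.\<close>

definition val :: "'v \<Rightarrow> 'v \<Rightarrow> ('v set \<times> bool) set" where
  "val p v = {y. if v = p then snd y else v \<in> fst y}"

definition holds :: "'v \<Rightarrow> ('v set \<times> bool) set \<Rightarrow> 'v set \<times> bool \<Rightarrow> 'v fm \<Rightarrow> bool" where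
  "holds p X x \<phi> \<longleftrightarrow> sat X (X \<times> X) (val p) x \<phi>"

lemma equiv_full: "equiv W (W \<times> W)"
  by (auto simp: equiv_def refl_on_def sym_def trans_def)

lemma quotient_full: "x \<in> W \<Longrightarrow> W \<in> W // (W \<times> W)"
  by (auto simp: quotient_def)

lemma S5_holds: "\<phi> \<in> S5 \<Longrightarrow> x \<in> X \<Longrightarrow> holds p X x \<phi>"
  using S5_valid_in[OF _ equiv_full[of X], of \<phi>] by (simp add: holds_def valid_in_def)

text \<open>Formulas over \<open>insert p A\<close> cannot separate points with equal state and
  equal value of \<open>p\<close>. Collapsing such points in an equivalence class yields a set of
  pairs inside \<open>Pow A \<times> UNIV\<close>.\<close>

lemma S5_iff_holds:
  assumes "vars \<phi> \<subseteq> insert p A"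
  shows "\<phi> \<in> S5 \<longleftrightarrow> (\<forall>X t a. X \<subseteq> Pow A \<times> UNIV \<longrightarrow> (t, a) \<in> X \<longrightarrow> holds p X (t, a) \<phi>)"
proof
  assume *: "\<forall>X t a. X \<subseteq> Pow A \<times> UNIV \<longrightarrow> (t, a) \<in> X \<longrightarrow> holds p X (t, a) \<phi>"
  have "sat W R V w \<phi>" if eq: "equiv W R" and w: "w \<in> W" for W :: "nat set" and R V w
  proof -
    define f where "f y = ({v \<in> A. y \<in> V v}, y \<in> V p)" for y
    let ?C = "R `` {w}"
    have "w \<in> ?C"
      using eq w by (rule equiv_class_self)
    moreover have "sat W R V w (subst Var \<phi>) \<longleftrightarrow> sat (f ` ?C) (f ` ?C \<times> f ` ?C) (val p) (f w) \<phi>"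
      by (rule sat_image[OF eq quotientI[OF w] \<open>w \<in> ?C\<close>]) (use assms in \<open>auto simp: val_def f_def\<close>)
    moreover have "f ` ?C \<subseteq> Pow A \<times> UNIV"
      by (auto simp: f_def)
    ultimately show ?thesis
      using * unfolding subst_Var holds_def by (metis image_eqI surj_pair)
  qed
  then show "\<phi> \<in> S5"
    by (auto simp: S5_def valid_in_def)
qed (auto intro: S5_holds)

text \<open>A triple stores a state and independent truth values of \<open>p\<close> and
  \<open>q\<close>. Reading \<open>\<phi>\<close> at \<open>p \<or> q\<close>, \<open>p\<close> or
  \<open>q\<close> amounts to projecting the triples to pairs, so additivity becomes a law about
  three projections of one set.\<close>

lemma additive_holds:
  assumes "additive S5 p q \<phi>" and "p \<noteq> q" and "q \<notin> vars \<phi>" and z: "(s, a, b) \<in> Z"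
  shows "holds p ((\<lambda>(s, a, b). (s, a \<or> b)) ` Z) (s, a \<or> b) \<phi> \<longleftrightarrow>
    holds p ((\<lambda>(s, a, b). (s, a)) ` Z) (s, a) \<phi> \<or> holds p ((\<lambda>(s, a, b). (s, b)) ` Z) (s, b) \<phi>"
proof -
  define V where
    "V v = {(s :: 'a set, a, b). if v = p then a else if v = q then b else v \<in> s}" for v
  note image = sat_image[OF equiv_full quotient_full[OF z] z, where U = "val p" and V = V and \<phi> = \<phi>]
  have "valid_in Z (Z \<times> Z) (Iff (subst1 \<phi> p (Or (Var p) (Var q))) (Or \<phi> (subst1 \<phi> p (Var q))))"
    using assms(1) equiv_full unfolding additive_def by (rule S5_valid_in)
  then have "sat Z (Z \<times> Z) V (s, a, b) (subst1 \<phi> p (Or (Var p) (Var q))) \<longleftrightarrow>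
      sat Z (Z \<times> Z) V (s, a, b) (subst Var \<phi>) \<or> sat Z (Z \<times> Z) V (s, a, b) (subst1 \<phi> p (Var q))"
    using z unfolding valid_in_def subst_Var by auto
  also have "sat Z (Z \<times> Z) V (s, a, b) (subst1 \<phi> p (Or (Var p) (Var q))) \<longleftrightarrow>
      holds p ((\<lambda>(s, a, b). (s, a \<or> b)) ` Z) (s, a \<or> b) \<phi>"
    unfolding subst1_def holds_def
    by (subst image[where f = "\<lambda>(s, a, b). (s, a \<or> b)"]) (use assms in \<open>auto simp: val_def V_def\<close>)
  also have "sat Z (Z \<times> Z) V (s, a, b) (subst Var \<phi>) \<longleftrightarrow>
      holds p ((\<lambda>(s, a, b). (s, a)) ` Z) (s, a) \<phi>"
    unfolding holds_def
    by (subst image[where f = "\<lambda>(s, a, b). (s, a)"]) (use assms in \<open>auto simp: val_def V_def\<close>)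
  also have "sat Z (Z \<times> Z) V (s, a, b) (subst1 \<phi> p (Var q)) \<longleftrightarrow>
      holds p ((\<lambda>(s, a, b). (s, b)) ` Z) (s, b) \<phi>"
    unfolding subst1_def holds_def
    by (subst image[where f = "\<lambda>(s, a, b). (s, b)"]) (use assms in \<open>auto simp: val_def V_def\<close>)
  finally show ?thesis .
qed

section \<open>Decomposition of additive functions on clusters\<close>

text \<open>Marked states also keep their unmarked copies when \<open>A \<subseteq> T\<close>. The
  realised states are then \<open>T\<close> for every choice of \<open>A\<close>, and the marks can
  be varied freely.\<close>

definition marked :: "'s set \<Rightarrow> 's set \<Rightarrow> ('s \<times> bool) set" where
  "marked T A = T \<times> {False} \<union> A \<times> {True}"

lemma mem_marked: "(s, c) \<in> marked T A \<longleftrightarrow> (if c then s \<in> A else s \<in> T)"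
  by (auto simp: marked_def)

lemma mem_fst_image: "s \<in> fst ` X \<longleftrightarrow> (s, False) \<in> X \<or> (s, True) \<in> X"
proof -
  have "s \<in> fst ` X \<longleftrightarrow> (\<exists>b. (s, b) \<in> X)"
    by force
  then show ?thesis
    by (simp add: ex_bool_eq disj_commute)
qed

lemma mem_join_image:
  "(s, c) \<in> (\<lambda>(s, a, b). (s, a \<or> b)) ` Z \<longleftrightarrow>
    (if c then (s, True, False) \<in> Z \<or> (s, False, True) \<in> Z \<or> (s, True, True) \<in> Z
     else (s, False, False) \<in> Z)"
proof -
  have "(s, c) \<in> (\<lambda>(s, a, b). (s, a \<or> b)) ` Z \<longleftrightarrow> (\<exists>a b. (s, a, b) \<in> Z \<and> c = (a \<or> b))"
    by (auto simp: image_iff split_beta Bex_def)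
  then show ?thesis
    unfolding ex_bool_eq by (cases c) auto
qed

lemma mem_left_image:
  "(s, c) \<in> (\<lambda>(s, a, b). (s, a)) ` Z \<longleftrightarrow> (s, c, False) \<in> Z \<or> (s, c, True) \<in> Z"
proof -
  have "(s, c) \<in> (\<lambda>(s, a, b). (s, a)) ` Z \<longleftrightarrow> (\<exists>b. (s, c, b) \<in> Z)"
    by (auto simp: image_iff split_beta Bex_def)
  then show ?thesis
    by (simp add: ex_bool_eq disj_commute)
qed

lemma mem_right_image:
  "(s, c) \<in> (\<lambda>(s, a, b). (s, b)) ` Z \<longleftrightarrow> (s, False, c) \<in> Z \<or> (s, True, c) \<in> Z"
proof -
  have "(s, c) \<in> (\<lambda>(s, a, b). (s, b)) ` Z \<longleftrightarrow> (\<exists>a. (s, a, c) \<in> Z)"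
    by (auto simp: image_iff split_beta Bex_def)
  then show ?thesis
    by (simp add: ex_bool_eq disj_commute)
qed

lemmas mem_images = mem_marked mem_fst_image mem_join_image mem_left_image mem_right_image

text \<open>Only the projection law of \<open>F\<close> is used. Each step picks a set of triples
  whose three projections are the sets to be compared.\<close>

lemma additive_decomposition:
  fixes F :: "('s \<times> bool) set \<Rightarrow> 's \<times> bool \<Rightarrow> bool"
  assumes add: "\<And>Z s a b. (s, a, b) \<in> Z \<Longrightarrow>
      F ((\<lambda>(s, a, b). (s, a \<or> b)) ` Z) (s, a \<or> b) \<longleftrightarrow>
        F ((\<lambda>(s, a, b). (s, a)) ` Z) (s, a) \<or> F ((\<lambda>(s, a, b). (s, b)) ` Z) (s, b)"
    and fin: "finite X" and x: "(t, a) \<in> X" and T: "T = fst ` X"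
  shows "F X (t, a) \<longleftrightarrow>
    F (marked T {}) (t, False) \<or> (a \<and> F (marked T {t}) (t, True)) \<or>
    (\<exists>s. (s, True) \<in> X \<and> F (marked T {s}) (t, False))"
proof -
  have add': "F X0 (s, a \<or> b) \<longleftrightarrow> F X1 (s, a) \<or> F X2 (s, b)"
    if "(s, a, b) \<in> Z" "X0 = (\<lambda>(s, a, b). (s, a \<or> b)) ` Z"
      "X1 = (\<lambda>(s, a, b). (s, a)) ` Z" "X2 = (\<lambda>(s, a, b). (s, b)) ` Z" for s a b Z X0 X1 X2
    using add[OF that(1)] that(2-4) by simp
  have t: "t \<in> T"
    using x T by force
  define A where "A = {s. (s, True) \<in> X}"
  have "A \<subseteq> T"
    unfolding A_def T by force
  have union: "F (marked T (B \<union> C)) (t, False) \<longleftrightarrow>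
      F (marked T B) (t, False) \<or> F (marked T C) (t, False)" if "B \<subseteq> T" "C \<subseteq> T" for B C
  proof -
    \<comment> \<open>The left projection marks \<open>B\<close> and the right one marks
      \<open>C\<close>. Evaluation takes place at \<open>(t, False, False)\<close>, unmarked in all
      three projections.\<close>
    let ?Z = "T \<times> {(False, False)} \<union> B \<times> {(True, False)} \<union> C \<times> {(False, True)}"
    have Z: "marked T (B \<union> C) = (\<lambda>(s, a, b). (s, a \<or> b)) ` ?Z"
        "marked T B = (\<lambda>(s, a, b). (s, a)) ` ?Z" "marked T C = (\<lambda>(s, a, b). (s, b)) ` ?Z"
      using that by (auto simp: set_eq_iff mem_images)
    show ?thesis
      using add'[of t False False ?Z, OF _ Z] t by simp
  qed
  have fin_union: "F (marked T B) (t, False) \<longleftrightarrow>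
      F (marked T {}) (t, False) \<or> (\<exists>s\<in>B. F (marked T {s}) (t, False))"
    if "finite B" "B \<subseteq> T" for B
    using that
  proof (induction B rule: finite_induct)
    case (insert s B)
    then show ?case
      using union[of "{s}" B] by auto
  qed simp
  have "finite A"
    using finite_subset[OF \<open>A \<subseteq> T\<close>] fin T by simp
  note A_iff = fin_union[OF \<open>finite A\<close> \<open>A \<subseteq> T\<close>]
  \<comment> \<open>This is \<open>X\<close> with a left coordinate that is false everywhere: the
    join and the right projection are \<open>X\<close>, the left projection is
    \<open>marked T {}\<close>.\<close>
  let ?X = "{(s, a, b). \<not> a \<and> (s, b) \<in> X}"
  show ?thesis
  proof
    assume F: "F X (t, a)"
    \<comment> \<open>Each point of \<open>X\<close> with \<open>p\<close> true is split into one
      true only on the left and one true only on the right. The join is still \<open>X\<close>, but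
      both projections gain unmarked copies of all states.\<close>
    let ?Z = "A \<times> {(True, False), (False, True)} \<union> {s. (s, False) \<in> X} \<times> {(False, False)}"
    have Z: "X = (\<lambda>(s, a, b). (s, a \<or> b)) ` ?Z" "marked T A = (\<lambda>(s, a, b). (s, a)) ` ?Z"
        "marked T A = (\<lambda>(s, a, b). (s, b)) ` ?Z"
      by (auto simp: set_eq_iff mem_images A_def T)
    have "F (marked T A) (t, a) \<or> F (marked T A) (t, False)"
      using F add'[of t a False ?Z, OF _ Z] x by (cases a) (auto simp: A_def)
    moreover have "F (marked T {t}) (t, True) \<or> F (marked T A) (t, False)"
      if "F (marked T A) (t, True)" "a"
    proof -
      \<comment> \<open>The mark at the current point is separated from the others. The right
        projection has all marks of \<open>A\<close>, but the current point becomes an unmarked copy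
        there.\<close>
      let ?Y = "T \<times> {(False, False)} \<union> {(t, True, False)} \<union> A \<times> {(False, True)}"
      have "t \<in> A"
        using x \<open>a\<close> by (simp add: A_def)
      then have Y: "marked T A = (\<lambda>(s, a, b). (s, a \<or> b)) ` ?Y"
          "marked T {t} = (\<lambda>(s, a, b). (s, a)) ` ?Y" "marked T A = (\<lambda>(s, a, b). (s, b)) ` ?Y"
        using t \<open>A \<subseteq> T\<close> by (auto simp: set_eq_iff mem_images)
      show ?thesis
        using add'[of t True False ?Y, OF _ Y] that by simp
    qed
    ultimately show "F (marked T {}) (t, False) \<or> (a \<and> F (marked T {t}) (t, True)) \<or>
        (\<exists>s. (s, True) \<in> X \<and> F (marked T {s}) (t, False))"
      using A_iff unfolding A_def by (cases a) auto
  next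
    assume "F (marked T {}) (t, False) \<or> (a \<and> F (marked T {t}) (t, True)) \<or>
      (\<exists>s. (s, True) \<in> X \<and> F (marked T {s}) (t, False))"
    then consider "F (marked T {}) (t, False)" | "a" "F (marked T {t}) (t, True)"
      | s where "(s, True) \<in> X" "F (marked T {s}) (t, False)"
      by blast
    then show "F X (t, a)"
    proof cases
      case 1
      have Z: "X = (\<lambda>(s, a, b). (s, a \<or> b)) ` ?X" "marked T {} = (\<lambda>(s, a, b). (s, a)) ` ?X"
          "X = (\<lambda>(s, a, b). (s, b)) ` ?X"
        using 1 x by (auto simp: set_eq_iff mem_images T)
      show ?thesis
        using add'[of t False a ?X, OF _ Z] 1 x by auto
    next
      case 2
      \<comment> \<open>The extra point marks \<open>t\<close> on the left and leaves the join and
        the right projection equal to \<open>X\<close>, since \<open>(t, True)\<close> is already in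
        \<open>X\<close>.\<close>
      let ?Z = "insert (t, True, True) ?X"
      have Z: "X = (\<lambda>(s, a, b). (s, a \<or> b)) ` ?Z" "marked T {t} = (\<lambda>(s, a, b). (s, a)) ` ?Z"
          "X = (\<lambda>(s, a, b). (s, b)) ` ?Z"
        using 2 x by (auto simp: set_eq_iff mem_images T)
      show ?thesis
        using add'[of t True True ?Z, OF _ Z] 2 x by auto
    next
      case (3 s)
      let ?Z = "insert (s, True, True) ?X"
      have Z: "X = (\<lambda>(s, a, b). (s, a \<or> b)) ` ?Z" "marked T {s} = (\<lambda>(s, a, b). (s, a)) ` ?Z"
          "X = (\<lambda>(s, a, b). (s, b)) ` ?Z"
        using 3 x by (auto simp: set_eq_iff mem_images T)
      show ?thesis
        using add'[of t False a ?Z, OF _ Z] 3 x by auto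
    qed
  qed
qed

section \<open>Definability by formulas in the parameters\<close>

definition definable :: "'v \<Rightarrow> 'v set \<Rightarrow> ('v set set \<Rightarrow> 'v set \<Rightarrow> bool) \<Rightarrow> bool" where
  "definable p A D \<longleftrightarrow> (\<exists>\<delta>\<in>Fm A. \<forall>X t a. X \<subseteq> Pow A \<times> UNIV \<longrightarrow> (t, a) \<in> X \<longrightarrow>
     (holds p X (t, a) \<delta> \<longleftrightarrow> D (fst ` X) t))"

text \<open>Descriptions by the parameters in \<open>A\<close> identify states only among subsets of
  \<open>A\<close>, so properties need to be exchanged relative to
  \<open>T \<subseteq> Pow A\<close>.\<close>

lemma definable_cong:
  assumes "definable p A D"
    and "\<And>T t. T \<subseteq> Pow A \<Longrightarrow> t \<in> T \<Longrightarrow> D T t \<longleftrightarrow> E T t"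
  shows "definable p A E"
proof -
  obtain \<delta> where \<delta>: "\<delta> \<in> Fm A" "\<And>X t a. X \<subseteq> Pow A \<times> UNIV \<Longrightarrow> (t, a) \<in> X \<Longrightarrow>
      holds p X (t, a) \<delta> \<longleftrightarrow> D (fst ` X) t"
    using assms(1) unfolding definable_def by blast
  show ?thesis
    unfolding definable_def
  proof (intro bexI[of _ \<delta>] allI impI)
    fix X t and a :: bool
    assume X: "X \<subseteq> Pow A \<times> UNIV" "(t, a) \<in> X"
    then have "fst ` X \<subseteq> Pow A" "t \<in> fst ` X"
      by force+
    then show "holds p X (t, a) \<delta> \<longleftrightarrow> E (fst ` X) t"
      using \<delta>(2)[OF X] assms(2) by simp
  qed (rule \<delta>(1))
qed

lemma definable_Var:
  assumes "v \<in> A" and "p \<notin> A"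
  shows "definable p A (\<lambda>T t. v \<in> t)"
  unfolding definable_def
  by (rule bexI[of _ "Var v"]) (use assms in \<open>auto simp: holds_def val_def Fm_def\<close>)

lemma definable_False: "definable p A (\<lambda>T t. False)"
  unfolding definable_def by (rule bexI[of _ Bot]) (auto simp: holds_def Fm_def)

lemma definable_not:
  assumes "definable p A D"
  shows "definable p A (\<lambda>T t. \<not> D T t)"
proof -
  obtain \<delta> where "\<delta> \<in> Fm A" "\<forall>X t a. X \<subseteq> Pow A \<times> UNIV \<longrightarrow> (t, a) \<in> X \<longrightarrow>
      (holds p X (t, a) \<delta> \<longleftrightarrow> D (fst ` X) t)"
    using assms unfolding definable_def by blast
  then show ?thesis
    unfolding definable_def by (intro bexI[of _ "Neg \<delta>"]) (auto simp: holds_def Fm_def)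
qed

lemma definable_or:
  assumes "definable p A D" and "definable p A E"
  shows "definable p A (\<lambda>T t. D T t \<or> E T t)"
proof -
  obtain \<delta> where "\<delta> \<in> Fm A" "\<forall>X t a. X \<subseteq> Pow A \<times> UNIV \<longrightarrow> (t, a) \<in> X \<longrightarrow>
      (holds p X (t, a) \<delta> \<longleftrightarrow> D (fst ` X) t)"
    using assms(1) unfolding definable_def by blast
  moreover obtain \<epsilon> where "\<epsilon> \<in> Fm A" "\<forall>X t a. X \<subseteq> Pow A \<times> UNIV \<longrightarrow> (t, a) \<in> X \<longrightarrow>
      (holds p X (t, a) \<epsilon> \<longleftrightarrow> E (fst ` X) t)"
    using assms(2) unfolding definable_def by blast
  ultimately show ?thesis
    unfolding definable_def by (intro bexI[of _ "Or \<delta> \<epsilon>"]) (auto simp: holds_def Fm_def)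
qed

lemma definable_and:
  assumes "definable p A D" and "definable p A E"
  shows "definable p A (\<lambda>T t. D T t \<and> E T t)"
  using definable_not[OF definable_or[OF definable_not[OF assms(1)] definable_not[OF assms(2)]]]
  by simp

lemma definable_dia:
  assumes "definable p A D"
  shows "definable p A (\<lambda>T t. \<exists>s\<in>T. D T s)"
proof -
  obtain \<delta> where \<delta>: "\<delta> \<in> Fm A" "\<And>X t a. X \<subseteq> Pow A \<times> UNIV \<Longrightarrow> (t, a) \<in> X \<Longrightarrow>
      sat X (X \<times> X) (val p) (t, a) \<delta> \<longleftrightarrow> D (fst ` X) t"
    using assms unfolding definable_def holds_def by blast
  show ?thesis
    unfolding definable_def
  proof (intro bexI[of _ "Dia \<delta>"] allI impI)
    fix X t and a :: bool
    assume X: "X \<subseteq> Pow A \<times> UNIV" and "(t, a) \<in> X"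
    then have "holds p X (t, a) (Dia \<delta>) \<longleftrightarrow> (\<exists>u\<in>X. sat X (X \<times> X) (val p) u \<delta>)"
      by (auto simp: holds_def)
    also have "\<dots> \<longleftrightarrow> (\<exists>u\<in>X. D (fst ` X) (fst u))"
      by (intro bex_cong refl) (use \<delta>(2)[OF X] in auto)
    finally show "holds p X (t, a) (Dia \<delta>) \<longleftrightarrow> (\<exists>s\<in>fst ` X. D (fst ` X) s)"
      by simp
  qed (use \<delta>(1) in \<open>simp add: Fm_def\<close>)
qed

lemma definable_ex:
  assumes "finite I" and "\<And>i. i \<in> I \<Longrightarrow> definable p A (D i)"
  shows "definable p A (\<lambda>T t. \<exists>i\<in>I. D i T t)"
  using assms
proof (induction I rule: finite_induct)
  case empty
  then show ?case
    using definable_False by simp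
next
  case (insert i I)
  then show ?case
    using definable_or[of p A "D i"] by simp
qed

lemma definable_all:
  assumes "finite I" and "\<And>i. i \<in> I \<Longrightarrow> definable p A (D i)"
  shows "definable p A (\<lambda>T t. \<forall>i\<in>I. D i T t)"
  using definable_not[OF definable_ex[OF assms(1), OF definable_not[OF assms(2)]]] by simp

lemma definable_iff:
  assumes "definable p A D"
  shows "definable p A (\<lambda>T t. D T t \<longleftrightarrow> b)"
  using assms definable_not by (cases b) auto

lemma definable_state:
  assumes "finite A" and "p \<notin> A" and "s \<subseteq> A"
  shows "definable p A (\<lambda>T t. t = s)"
proof (rule definable_cong)
  show "definable p A (\<lambda>T t. \<forall>v\<in>A. v \<in> t \<longleftrightarrow> v \<in> s)"
    using assms by (intro definable_all definable_iff definable_Var)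
qed (use assms in blast)

text \<open>The formula behind this is the characteristic formula of a cluster: for each of the
  finitely many states it says whether some point has that state.\<close>

lemma definable_realised:
  assumes "finite A" and "p \<notin> A" and "S \<subseteq> Pow A"
  shows "definable p A (\<lambda>T t. T = S)"
proof (rule definable_cong)
  show "definable p A (\<lambda>T t. \<forall>s\<in>Pow A. (\<exists>u\<in>T. u = s) \<longleftrightarrow> s \<in> S)"
    using assms by (intro definable_all definable_iff definable_dia definable_state) auto
qed (use assms in blast)

text \<open>Only finitely many pairs of a set of states and a state exist, so \<open>D\<close> is
  the finite disjunction of the descriptions of the pairs satisfying it.\<close>

lemma definable_any:
  assumes "finite A" and "p \<notin> A"
  shows "definable p A D"
proof (rule definable_cong)
  show "definable p A (\<lambda>T t. \<exists>(S, s) \<in> {(S, s) \<in> Pow (Pow A) \<times> Pow A. D S s}. T = S \<and> t = s)"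
    unfolding split_def
    using assms by (intro definable_ex definable_and definable_realised definable_state) auto
qed auto

section \<open>The two directions of the characterisation\<close>

text \<open>In the normal form \<open>p\<close> occurs only under conjunction with parameter
  formulas and under \<open>Dia\<close>, both of which distribute over disjunction.\<close>

lemma additive_if_equivalent_A_S5:
  assumes "p \<notin> set rs" and "\<psi> \<in> A_S5 p rs" and eq: "equivalent S5 \<phi> \<psi>"
  shows "additive S5 p q \<phi>"
proof -
  obtain k :: nat and c l m n where
    \<psi>: "\<psi> = Or (Or (And l (Var p)) (BigOr (map (\<lambda>i. And (m i) (Dia (And (n i) (Var p)))) [0..<k]))) c"
    and Fm: "c \<in> Fm (set rs)" "l \<in> Fm (set rs)"
      "\<And>i. i < k \<Longrightarrow> m i \<in> Fm (set rs)" "\<And>i. i < k \<Longrightarrow> n i \<in> Fm (set rs)"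
    using assms(2) unfolding A_S5_def by blast
  have fresh: "subst1 \<theta> p \<chi> = \<theta>" if "\<theta> \<in> Fm (set rs)" for \<theta> \<chi>
    using that assms(1) by (intro subst1_fresh) (auto simp: Fm_def)
  show ?thesis
    unfolding additive_def S5_def valid_in_def mem_Collect_eq
  proof (intro allI impI ballI)
    fix W :: "nat set" and R V w
    assume W: "equiv W R" "w \<in> W"
    \<comment> \<open>All valuations \<open>U\<close> are covered because substituting for
      \<open>p\<close> amounts to changing the valuation.\<close>
    have \<phi>\<psi>: "sat W R U w \<phi> \<longleftrightarrow> sat W R U w \<psi>" for U
      using eq W by (auto simp: equivalent_def S5_def valid_in_def)
    have "sat W R V w (Iff (subst1 \<phi> p \<chi>) (subst1 \<psi> p \<chi>))" for \<chi>
      unfolding subst1_def using \<phi>\<psi> by (simp add: sat_subst)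
    then show "sat W R V w
        (Iff (subst1 \<phi> p (Or (Var p) (Var q))) (Or \<phi> (subst1 \<phi> p (Var q))))"
      using \<phi>\<psi>[of V] fresh Fm
      unfolding \<psi> subst1_def by (auto simp: sat_BigOr subst_BigOr)
  qed
qed

text \<open>Each of the three conditions in the decomposition is a property of realised states and
  current state, hence defined by a parameter formula. These formulas become \<open>c\<close>,
  \<open>l\<close> and \<open>m s\<close>.\<close>

lemma equivalent_A_S5_if_additive:
  assumes "additive S5 p q \<phi>" and "p \<noteq> q" and p: "p \<notin> set rs" and "q \<notin> set rs"
    and \<phi>: "\<phi> \<in> Fm (insert p (set rs))"
  shows "\<exists>\<psi>\<in>A_S5 p rs. equivalent S5 \<phi> \<psi>"
proof -
  let ?A = "set rs"
  let ?F = "\<lambda>X x. holds p X x \<phi>"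
  have any: "\<exists>\<delta>\<in>Fm ?A. \<forall>X t a. X \<subseteq> Pow ?A \<times> UNIV \<longrightarrow> (t, a) \<in> X \<longrightarrow>
     (holds p X (t, a) \<delta> \<longleftrightarrow> D (fst ` X) t)" for D
    using definable_any[OF finite_set p] unfolding definable_def by blast
  obtain ss where ss: "set ss = Pow ?A"
    using finite_list[of "Pow ?A"] by auto
  obtain c where c: "c \<in> Fm ?A" "\<And>X t a. X \<subseteq> Pow ?A \<times> UNIV \<Longrightarrow> (t, a) \<in> X \<Longrightarrow>
      holds p X (t, a) c \<longleftrightarrow> ?F (marked (fst ` X) {}) (t, False)"
    using any[of "\<lambda>T t. ?F (marked T {}) (t, False)"] by blast
  obtain l where l: "l \<in> Fm ?A" "\<And>X t a. X \<subseteq> Pow ?A \<times> UNIV \<Longrightarrow> (t, a) \<in> X \<Longrightarrow>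
      holds p X (t, a) l \<longleftrightarrow> ?F (marked (fst ` X) {t}) (t, True)"
    using any[of "\<lambda>T t. ?F (marked T {t}) (t, True)"] by blast
  obtain m where m: "\<And>s. m s \<in> Fm ?A" "\<And>s X t a. X \<subseteq> Pow ?A \<times> UNIV \<Longrightarrow> (t, a) \<in> X \<Longrightarrow>
      holds p X (t, a) (m s) \<longleftrightarrow> ?F (marked (fst ` X) {s}) (t, False)"
    using any[of "\<lambda>T t. ?F (marked T {s}) (t, False)" for s] by metis
  obtain n where n: "\<And>s. n s \<in> Fm ?A" "\<And>s X t a. X \<subseteq> Pow ?A \<times> UNIV \<Longrightarrow> (t, a) \<in> X \<Longrightarrow>
      holds p X (t, a) (n s) \<longleftrightarrow> t = s"
    using any[of "\<lambda>T t. t = s" for s] by metis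
  \<comment> \<open>There is one disjunct for each state in the enumeration \<open>ss\<close>. Its
    diamond says that some point with this state satisfies \<open>p\<close>.\<close>
  define \<psi> where "\<psi> = Or (Or (And l (Var p))
    (BigOr (map (\<lambda>i. And (m (ss ! i)) (Dia (And (n (ss ! i)) (Var p)))) [0..<length ss]))) c"
  have "\<psi> \<in> A_S5 p rs"
    unfolding \<psi>_def A_S5_def
    by (rule CollectI, rule exI[of _ "length ss"], rule exI[of _ c], rule exI[of _ l],
        rule exI[of _ "\<lambda>i. m (ss ! i)"], rule exI[of _ "\<lambda>i. n (ss ! i)"])
      (use c(1) l(1) m(1) n(1) in simp)
  moreover have "equivalent S5 \<phi> \<psi>"
  proof -
    have "holds p X (t, a) \<phi> \<longleftrightarrow> holds p X (t, a) \<psi>"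
      if X: "X \<subseteq> Pow ?A \<times> UNIV" and x: "(t, a) \<in> X" for X t a
    proof -
      have "q \<notin> vars \<phi>"
        using assms(2,4) \<phi> by (auto simp: Fm_def)
      have "finite X"
        using X by (rule finite_subset) simp
      have \<phi>_iff: "holds p X (t, a) \<phi> \<longleftrightarrow> holds p X (t, a) c \<or> (a \<and> holds p X (t, a) l) \<or>
          (\<exists>s. (s, True) \<in> X \<and> holds p X (t, a) (m s))"
        unfolding c(2)[OF X x] l(2)[OF X x] m(2)[OF X x]
        by (rule additive_decomposition[OF
              additive_holds[OF assms(1) \<open>p \<noteq> q\<close> \<open>q \<notin> vars \<phi>\<close>] \<open>finite X\<close> x refl])
      have states_iff: "(\<exists>s. (s, True) \<in> X \<and> holds p X (t, a) (m s)) \<longleftrightarrow>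
          (\<exists>s\<in>set ss. holds p X (t, a) (m s) \<and> (\<exists>u\<in>X. holds p X u (n s) \<and> snd u))"
      proof -
        have realised: "(\<exists>u\<in>X. holds p X u (n s) \<and> snd u) \<longleftrightarrow> (s, True) \<in> X" for s
        proof
          assume "\<exists>u\<in>X. holds p X u (n s) \<and> snd u"
          then obtain t' where "(t', True) \<in> X" "holds p X (t', True) (n s)"
            by auto
          then show "(s, True) \<in> X"
            using n(2)[OF X, of t' True s] by simp
        next
          assume "(s, True) \<in> X"
          then show "\<exists>u\<in>X. holds p X u (n s) \<and> snd u"
            using n(2)[OF X, of s True s] by (intro bexI[of _ "(s, True)"]) simp_all
        qed
        have "s \<in> Pow ?A" if "(s, True) \<in> X" for s
          using that X by auto
        then show ?thesis
          unfolding ss realised by blast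
      qed
      have \<psi>_iff: "holds p X (t, a) \<psi> \<longleftrightarrow>
          holds p X (t, a) c \<or> (a \<and> holds p X (t, a) l) \<or>
          (\<exists>s\<in>set ss. holds p X (t, a) (m s) \<and> (\<exists>u\<in>X. holds p X u (n s) \<and> snd u))"
      proof -
        have "set ss = (\<lambda>i. ss ! i) ` {0..<length ss}"
          by (auto simp: set_conv_nth)
        then show ?thesis
          unfolding \<psi>_def using x by (auto simp: holds_def sat_BigOr val_def)
      qed
      show ?thesis
        unfolding \<phi>_iff states_iff \<psi>_iff ..
    qed
    moreover have "vars (Iff \<phi> \<psi>) \<subseteq> insert p ?A"
      using \<phi> c(1) l(1) m(1) n(1) unfolding \<psi>_def Fm_def by (auto simp: vars_BigOr; blast)
    ultimately show ?thesis
      unfolding equivalent_def by (subst S5_iff_holds) (auto simp: holds_def)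
  qed
  ultimately show ?thesis ..
qed

theorem theorem4p4:
  fixes p q :: 'v and rs :: "'v list" and \<phi> :: "'v fm"
  assumes "p \<noteq> q" and "p \<notin> set rs" and "q \<notin> set rs"
    and "\<phi> \<in> Fm (insert p (set rs))"
  shows "additive S5 p q \<phi> \<longleftrightarrow> (\<exists>\<psi>\<in>A_S5 p rs. equivalent S5 \<phi> \<psi>)"
  using equivalent_A_S5_if_additive[OF _ assms] additive_if_equivalent_A_S5[OF assms(2)] by blast

end
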